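(* Consider the setting described in the context, where the weak estimator $\widehat\Theta_{\mathrm w}$ is the constrained maximum likelihood estimator, and assume all hypotheses (A1)–(A8) listed there. Assume moreover that the following three conditions hold. (i) The labeled sample size $n$ is large enough that $$B_\Theta^2\,d_{\mathrm w}\exp\Big(-\frac{n\lambda_{\min}(\Sigma_{\mathrm w})}{8B_\phi^2}\Big)\lesssim\frac{\operatorname{tr}(\Sigma_{\mathrm w})}{\mu_{\mathrm w}^2\,n}.$$ (ii) $$\mathcal E_{\mathrm{imit}}+\mathcal E_{\mathrm{approx}}+\frac{C_{\mathrm t}d_{\mathrm s\wedge\mathrm w}}{n}<\mu\gamma^2\frac{e^{-4B_\eta}}{K^2}\Big(\rho_{\mathrm s}+\frac{\lambda_{\min}(\Lambda_{\mathrm s})\operatorname{tr}(\Sigma_\varphi)}{L_H^2n}\Big),$$ equivalently, $\mathcal M_n>0$. (iii) The unlabeled sample size $N$ is large enough: $$N\gtrsim\max\left\{d_{\mathrm s},\ \left(\frac{C_N+\sqrt{C_N^2+4\mathcal M_nC_{\mathrm t}d_{\mathrm s}(d_{\mathrm w}-d_{\mathrm s\wedge\mathrm w})/n}}{2\mathcal M_n}\right)^2\right\}.$$ Under these conditions, the bounds (U), (S), (W) recalled in the context certify, up to universal constants, that $$\mathbb E_{\tilde{\mathcal B},\mathcal B}\big[R(\widehat\pi_{\mathrm{w2s}})-R^*\big]\le\mathbb E_{\tilde{\mathcal B}}\big[R(\widehat\pi_{\mathrm s})-R^*\big].$$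
   Context: Notation: $\lesssim$ (and $\gtrsim$) denotes inequality up to a universal constant factor, independent of any problem parameters. $[K]=\{1,\dots,K\}$; $\operatorname{softmax}_k(\eta)=e^{\eta_k}/\sum_je^{\eta_j}$. Decision problem: $\Xi=\{z_1,\dots,z_K\}$ is finite, $\Delta(\Xi)$ is the set of probability distributions on $\Xi$ (identified with vectors in $\mathbb R^K$), $\mathcal X\subseteq\mathbb R^{d_x}$, the action set is $\mathcal A=\mathbb R^d$, and $c:\mathcal A\times\Xi\to\mathbb R$ is a cost. $\mathcal D$ is the joint law of $(x,\xi)\in\mathcal X\times\Xi$, $\mathcal D_x$ its marginal on $x$ ($\mathbb E_x$: expectation over $x\sim\mathcal D_x$), $P^*(x)=P^*(\cdot\mid x)$ the conditional law of $\xi$ given $x$. For $p\in\Delta(\Xi)$, $\tilde w(p)\in\arg\min_{w\in\mathcal A}\mathbb E_{\xi\sim p}[c(w,\xi)]$. $R(\pi)=\mathbb E_{(x,\xi)\sim\mathcal D}[c(\pi(x),\xi)]$ for $\pi:\mathcal X\to\mathcal A$; $R^*=\mathbb E_{(x,\xi)\sim\mathcal D}[c(\tilde w(P^*(x)),\xi)]$. Data: $\tilde{\mathcal B}=\{(\tilde x_i,\tilde\xi_i)\}_{i=1}^n$ i.i.d. from $\mathcal D$; $\mathcal B=\{x_j\}_{j=1}^N$ i.i.d. from $\mathcal D_x$, independent of $\tilde{\mathcal B}$. Features: $\phi_{\mathrm s},\phi_{\mathrm w}:\mathcal X\to\mathbb R^{d_\phi}$; $P_\Theta^{\mathrm s}(x)=\operatorname{softmax}(\Theta^\top\phi_{\mathrm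 s}(x))$, $P_\Theta^{\mathrm w}(x)=\operatorname{softmax}(\Theta^\top\phi_{\mathrm w}(x))$ for $\Theta\in\mathbb R^{d_\phi\times K}$. $\Sigma_{\mathrm s}=\mathbb E_x[\phi_{\mathrm s}\phi_{\mathrm s}^\top]=V_{\mathrm s}\Lambda_{\mathrm s}V_{\mathrm s}^\top$, $\Sigma_{\mathrm w}=\mathbb E_x[\phi_{\mathrm w}\phi_{\mathrm w}^\top]=V_{\mathrm w}\Lambda_{\mathrm w}V_{\mathrm w}^\top$ are reduced spectral decompositions ($\Lambda$'s diagonal with the positive eigenvalues, $V$'s with orthonormal columns), $d_{\mathrm s},d_{\mathrm w}$ the ranks, $\Sigma^{-1/2}:=V\Lambda^{-1/2}V^\top$, and $d_{\mathrm s\wedge\mathrm w}=\|\Sigma_{\mathrm s}^{-1/2}\mathbb E_x[\phi_{\mathrm s}\phi_{\mathrm w}^\top]\Sigma_{\mathrm w}^{-1/2}\|_F^2$. $\rho_{\mathrm s}=\min_{\Theta\mathbf 1=0}\mathbb E_x\|\Theta^\top\phi_{\mathrm s}(x)-\eta^*(x)\|_2^2$, $\rho_{\mathrm w}=\min_{\Theta\mathbf 1=0}\mathbb E_x\|\Theta^\top\phi_{\mathrm w}(x)-\eta^*(x)\|_2^2$ ($\eta^*$ from (A1)), with minimizers $\Theta_{\mathrm s}^*,\Theta_{\mathrm w}^*$. Estimators. Weak (MLE): with $\mathcal C_B=\{\Theta\in\mathbb R^{d_\phi\times K}:\Theta\mathbf 1=0,\|\Theta\|_F\le B_\Theta\}$,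 $B_\Theta>0$, $\widehat\Theta_{\mathrm w}\in\arg\min_{\Theta\in\mathcal C_B}-\frac1n\sum_{i=1}^n\ln P_\Theta^{\mathrm w}(\tilde\xi_i\mid\tilde x_i)$; the symbol $B_\Theta^{\mathrm w}$ denotes an almost sure bound on $\|\widehat\Theta_{\mathrm w}\|_F$. W2S: for a constant $B>0$ and $\mathcal H_B=\{\Theta\in\mathbb R^{d_\phi\times K}:\|\Theta\|_F\le B\}$, $\widehat\Theta_{\mathrm{w2s}}\in\arg\min_{\Theta\in\mathcal H_B}\frac1N\sum_{j=1}^N\mathbb E_{\xi\sim P^{\mathrm w}_{\widehat\Theta_{\mathrm w}}(\cdot\mid x_j)}[c(\tilde w(P_\Theta^{\mathrm s}(x_j)),\xi)]$, $\widehat\pi_{\mathrm{w2s}}(x)=\tilde w(P^{\mathrm s}_{\widehat\Theta_{\mathrm{w2s}}}(x))$. Least squares: $\widehat\Theta_{\mathrm{ls}}\in\arg\min_{\Theta\in\mathbb R^{d_\phi\times K}}\frac1N\sum_{j}\|\Theta^\top\phi_{\mathrm s}(x_j)-\widehat\Theta_{\mathrm w}^\top\phi_{\mathrm w}(x_j)\|_2^2$. Strong-only: $\widehat\Theta_{\mathrm s}\in\arg\min_{\Theta\mathbf 1=0}\frac1n\sum_{i=1}^nc(\tilde w(P_\Theta^{\mathrm s}(\tilde x_i)),\tilde\xi_i)$ (assumed to exist almost surely), $\widehat\pi_{\mathrm s}(x)=\tilde w(P^{\mathrm s}_{\widehat\Theta_{\mathrm s}}(x))$. Hypotheses. (A1)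 There is a measurable $\eta^*:\mathcal X\to\mathbb R^K$ with $P^*(\xi=z_k\mid x)=\operatorname{softmax}_k(\eta^*(x))$, $\eta^*(x)^\top\mathbf 1=0$ for all $x$, $\mathbb E_x\|\eta^*(x)\|_2^4<\infty$. (A2) Each $c(\cdot,z_k)$ is $\mu$-strongly convex and $L$-smooth, i.e. $\mu I\preceq\nabla_a^2c(a,z_k)\preceq LI$ for all $a\in\mathcal A$, $k\in[K]$, and $\|\nabla_ac(a,z_k)\|_2\le G$ for all $k$ and $a\in\operatorname{conv}\{\tilde w(p):p\in\Delta(\Xi)\}$. (A3) $\|\widehat\Theta_{\mathrm{ls}}\|_F\le B$ almost surely. (A4) With $\phi=[\phi_{\mathrm s};\phi_{\mathrm w}]\in\mathbb R^{2d_\phi}$ and covariance $\Sigma_\phi$, there is $\kappa>0$ such that $\mathbb E_x[e^{u^\top\phi(x)}]\le e^{\frac12\kappa^2u^\top\Sigma_\phi u}$ for all $u\in\mathbb R^{2d_\phi}$. (A5) There is $\gamma>0$ such that for all $x\in\mathcal X$, almost surely, $\|\tilde w(P^{\mathrm s}_{\widehat\Theta_{\mathrm s}}(x))-\tilde w(P^*(x))\|_2\ge\gamma\|P^{\mathrm s}_{\widehat\Theta_{\mathrm s}}(x)-P^*(x)\|_2$; and there is $B_\eta>0$ with $\|\widehat\Theta_{\mathrm s}^\top\phi_{\mathrm s}(x)\|_\infty\le B_\eta$, $\|\eta^*(x)\|_\infty\le B_\eta$. (A6) There is $L_H>0$ such that, almost surely over $\tilde{\mathcal B}$, for all $\Theta$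 on the segment between $\Theta_{\mathrm s}^*$ and $\widehat\Theta_{\mathrm s}$, the Hessian (with respect to $\operatorname{vec}(\Theta)\in\mathbb R^{d_\phi K}$) of $\frac1n\sum_{i=1}^nc(\tilde w(P_\Theta^{\mathrm s}(\tilde x_i)),\tilde\xi_i)$ lies between $-L_HI$ and $L_HI$. (A7) $\rho_{\mathrm w}=0$, the minimizer $\Theta_{\mathrm w}^*$ is unique, and $\|\Theta_{\mathrm w}^*\|_F<B_\Theta$. (A8) There is $B_\phi>0$ with $\|\phi_{\mathrm w}(x)\|_2\le B_\phi$ for all $x\in\mathcal X$. Quantities. $\mu_{\mathrm w}=\frac{e^{-2B_\Theta B_\phi}}{K}\lambda_{\min}(\Sigma_{\mathrm w})$. $\Sigma_\varphi$ is the covariance of $\varphi=\operatorname{vec}(\nabla_\Theta c(\tilde w(P_\Theta^{\mathrm s}(x)),\xi)|_{\Theta=\Theta_{\mathrm s}^*})$, $(x,\xi)\sim\mathcal D$. $\rho_{\mathrm s\to\mathrm w}(\widehat\Theta_{\mathrm w})=\inf_{\Theta\in\mathcal H_B}\mathbb E_x\|\Theta^\top\phi_{\mathrm s}(x)-\widehat\Theta_{\mathrm w}^\top\phi_{\mathrm w}(x)\|_2^2$. $C_{\mathrm{unif}}=\max_{k\in[K]}|c(\tilde w(\operatorname{softmax}(0)),z_k)|$. $\mathcal E_{\mathrm{imit}}=\big(\frac{L^2KG^2}{\mu^3}+\frac{LKG^2}{\mu^2}\big)\mathbb E_{\tilde{\mathcal B}}[\rho_{\mathrm s\to\mathrm w}(\widehat\Theta_{\mathrm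 w})]$; $\mathcal E_{\mathrm{approx}}=\frac{LKG^2}{\mu^2}(\rho_{\mathrm w}+\rho_{\mathrm s})$; $\mathcal E_{\mathrm{teacher}}=\frac{LKG^2}{\mu^2}\lambda_{\max}(\Lambda_{\mathrm w})\mathbb E_{\tilde{\mathcal B}}[\|\widehat\Theta_{\mathrm w}-\Theta_{\mathrm w}^*\|_F^2]\big(d_{\mathrm s\wedge\mathrm w}+\frac1Nd_{\mathrm s}(d_{\mathrm w}-d_{\mathrm s\wedge\mathrm w})\big)$; $C_{\mathrm t}=\frac{4LKG^2}{\mu^2\mu_{\mathrm w}^2}\lambda_{\max}(\Lambda_{\mathrm w})\operatorname{tr}(\Sigma_{\mathrm w})$; $$\begin{aligned}C_N=&\Big(\tfrac{L^2KG^2}{\mu^3}+\tfrac{LKG^2}{\mu^2}\Big)\Big[(B_\Theta^{\mathrm w})^2(\mathbb E_x\|\phi_{\mathrm w}\|_2^4)^{1/2}+B^2(\mathbb E_x\|\phi_{\mathrm s}\|_2^4)^{1/2}+BB_\Theta^{\mathrm w}(\mathbb E_x[\|\phi_{\mathrm s}\|_2^2\|\phi_{\mathrm w}\|_2^2])^{1/2}\Big]\\&+\tfrac{LKG^2}{\mu^2}\Big[(\mathbb E_x\|\eta^*\|_2^4)^{1/2}+B\sqrt{\operatorname{tr}(\Sigma_{\mathrm s})}+B(\mathbb E_x\|\eta^*\|_2^4)^{1/4}(\mathbb E_x\|\phi_{\mathrm s}\|_2^4)^{1/4}\Big]+\tfrac{LC_{\mathrm{unif}}}{\mu};\end{aligned}$$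 $$\mathcal M_n=\mu\gamma^2\tfrac{e^{-4B_\eta}}{K^2}\Big(\rho_{\mathrm s}+\tfrac{\lambda_{\min}(\Lambda_{\mathrm s})\operatorname{tr}(\Sigma_\varphi)}{L_H^2n}\Big)-\mathcal E_{\mathrm{imit}}-\mathcal E_{\mathrm{approx}}-\tfrac{C_{\mathrm t}d_{\mathrm s\wedge\mathrm w}}{n}.$$ Bounds referred to in the claim (results of the same work under these hypotheses). (U) Whenever $N\gtrsim d_{\mathrm s}$: $\mathbb E_{\tilde{\mathcal B},\mathcal B}[R(\widehat\pi_{\mathrm{w2s}})-R^*]\lesssim\mathcal E_{\mathrm{imit}}+\frac{C_N}{\sqrt N}+\mathcal E_{\mathrm{teacher}}+\mathcal E_{\mathrm{approx}}$. (S) $\mathbb E_{\tilde{\mathcal B}}[R(\widehat\pi_{\mathrm s})-R^*]\gtrsim\mu\gamma^2\frac{e^{-4B_\eta}}{K^2}\big(\rho_{\mathrm s}+\frac{\lambda_{\min}(\Lambda_{\mathrm s})\operatorname{tr}(\Sigma_\varphi)}{L_H^2}\frac1n\big)$. (W) $\mathbb E_{\tilde{\mathcal B}}[\|\widehat\Theta_{\mathrm w}-\Theta_{\mathrm w}^*\|_F^2]\le\frac{4}{\mu_{\mathrm w}^2}\frac{\operatorname{tr}(\Sigma_{\mathrm w})}{n}+4B_\Theta^2d_{\mathrm w}\exp\big(-\frac{n\lambda_{\min}(\Sigma_{\mathrm w})}{8B_\phi^2}\big)$. *)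

theory Defs
  imports "HOL-Probability.Probability"
begin

section \<open>Calculus and linear algebra\<close>

definition grad :: "('v::euclidean_space \<Rightarrow> real) \<Rightarrow> 'v \<Rightarrow> 'v" where
  "grad f x = (\<Sum>b\<in>Basis. frechet_derivative f (at x) b *\<^sub>R b)"

definition twice_differentiable_at :: "('v::euclidean_space \<Rightarrow> real) \<Rightarrow> 'v \<Rightarrow> bool" where
  "twice_differentiable_at f x \<longleftrightarrow>
     (\<forall>\<^sub>F y in nhds x. f differentiable (at y)) \<and> grad f differentiable (at x)"

definition hess :: "('v::euclidean_space \<Rightarrow> real) \<Rightarrow> 'v \<Rightarrow> 'v \<Rightarrow> 'v" where
  "hess f x = frechet_derivative (grad f) (at x)"

text \<open>The Hessian of f at x exists and lies between l I and u I in the Loewner order. For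
  matrix arguments (type real^'k^'p) the inner product is the Frobenius one, so this is the
  statement about the Hessian with respect to the vectorised matrix.\<close>

definition hess_between :: "('v::euclidean_space \<Rightarrow> real) \<Rightarrow> 'v \<Rightarrow> real \<Rightarrow> real \<Rightarrow> bool" where
  "hess_between f x l u \<longleftrightarrow> twice_differentiable_at f x \<and>
     (\<forall>h. l * (h \<bullet> h) \<le> h \<bullet> hess f x h \<and> h \<bullet> hess f x h \<le> u * (h \<bullet> h))"

text \<open>Smallest eigenvalue of a symmetric matrix (possibly 0, unlike diag_min below).\<close>

definition lambda_min :: "real^'n^'n \<Rightarrow> real" where
  "lambda_min A = Min {l. \<exists>v. v \<noteq> 0 \<and> A *v v = l *\<^sub>R v}"

text \<open>A reduced spectral decomposition A = V diag(lam) V^T. The number of columns of V is the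
  rank of A, which is not a type, so the columns are given as vectors V 0, ..., V (rank A - 1).\<close>

definition reduced_spectral :: "real^'n^'n \<Rightarrow> (nat \<Rightarrow> real^'n) \<Rightarrow> (nat \<Rightarrow> real) \<Rightarrow> bool" where
  "reduced_spectral A V lam \<longleftrightarrow>
     (\<forall>i<rank A. lam i > 0) \<and>
     (\<forall>i<rank A. \<forall>j<rank A. V i \<bullet> V j = (if i = j then 1 else 0)) \<and>
     A = (\<chi> a b. \<Sum>i<rank A. lam i * V i $ a * V i $ b)"

text \<open>V diag(lam)^(-1/2) V^T for a reduced spectral decomposition with r columns.\<close>

definition spectral_inv_sqrt :: "nat \<Rightarrow> (nat \<Rightarrow> real^'n) \<Rightarrow> (nat \<Rightarrow> real) \<Rightarrow> real^'n^'n" where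
  "spectral_inv_sqrt r V lam = (\<chi> a b. \<Sum>i<r. (1 / sqrt (lam i)) * V i $ a * V i $ b)"

text \<open>Largest and smallest diagonal entry of the r by r matrix diag(lam), with value 0 for the
  empty matrix.\<close>

definition diag_max :: "nat \<Rightarrow> (nat \<Rightarrow> real) \<Rightarrow> real" where
  "diag_max r lam = (if r = 0 then 0 else Max (lam ` {..<r}))"

definition diag_min :: "nat \<Rightarrow> (nat \<Rightarrow> real) \<Rightarrow> real" where
  "diag_min r lam = (if r = 0 then 0 else Min (lam ` {..<r}))"

definition vectorise :: "real^'k^'p \<Rightarrow> real^('p \<times> 'k)" where
  "vectorise T = (\<chi> i. T $ fst i $ snd i)"

definition stack :: "real^'p \<Rightarrow> real^'q \<Rightarrow> real^('p + 'q)" where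
  "stack u v = (\<chi> i. case i of Inl a \<Rightarrow> u $ a | Inr b \<Rightarrow> v $ b)"


section \<open>Probability vectors, second moments, covariances\<close>

definition prob_vectors :: "(real^'k) set" where
  "prob_vectors = {p. (\<forall>k. 0 \<le> p $ k) \<and> (\<Sum>k\<in>UNIV. p $ k) = 1}"

definition softmax :: "real^'k \<Rightarrow> real^'k" where
  "softmax v = (\<chi> k. exp (v $ k) / (\<Sum>j\<in>UNIV. exp (v $ j)))"

definition logits :: "('x \<Rightarrow> real^'p) \<Rightarrow> real^'k^'p \<Rightarrow> 'x \<Rightarrow> real^'k" where
  "logits phi T x = transpose T *v phi x"

definition cross_moment :: "'a measure \<Rightarrow> ('a \<Rightarrow> real^'p) \<Rightarrow> ('a \<Rightarrow> real^'q) \<Rightarrow> real^'q^'p" where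
  "cross_moment M f g = (\<chi> i j. \<integral>x. f x $ i * g x $ j \<partial>M)"

definition covariance_matrix :: "'a measure \<Rightarrow> ('a \<Rightarrow> real^'n) \<Rightarrow> real^'n^'n" where
  "covariance_matrix M f =
     (\<chi> i j. \<integral>x. (f x $ i - (\<integral>y. f y $ i \<partial>M)) * (f x $ j - (\<integral>y. f y $ j \<partial>M)) \<partial>M)"


section \<open>The setting\<close>

text \<open>The outcome set {z_1, ..., z_K} is the finite type 'k (so K = CARD('k)), the action set is
  real^'d, contexts lie in a subset of real^'x, features are real^'p valued, and parameter
  matrices in R^(d_phi x K) have type real^'k^'p, on which norm is the Frobenius norm.
  Estimators are functions of the labeled sample (indices below n) and, where applicable, of the
  unlabeled sample (indices below N). The scalar fields are mu, L, G (cost regularity), B (radius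
  of H_B), B_Theta (radius of C_B), c_B_Theta_w (the almost sure bound on the weak estimator,
  B_Theta^w), gamma, B_eta, L_H and B_phi.\<close>

record ('d, 'x, 'p, 'k) w2s_problem =
  contexts    :: "(real^'x) set"
  joint       :: "((real^'x) \<times> 'k) measure"
  cost        :: "real^'d \<Rightarrow> 'k \<Rightarrow> real"
  w_opt       :: "real^'k \<Rightarrow> real^'d"
  P_star      :: "real^'x \<Rightarrow> real^'k"
  eta_star    :: "real^'x \<Rightarrow> real^'k"
  phi_s       :: "real^'x \<Rightarrow> real^'p"
  phi_w       :: "real^'x \<Rightarrow> real^'p"
  V_s         :: "nat \<Rightarrow> real^'p"
  Lam_s       :: "nat \<Rightarrow> real"
  V_w         :: "nat \<Rightarrow> real^'p"
  Lam_w       :: "nat \<Rightarrow> real"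
  n_lab       :: nat
  n_unl       :: nat
  Theta_s_star :: "real^'k^'p"
  Theta_w_star :: "real^'k^'p"
  Theta_w_hat  :: "(nat \<Rightarrow> (real^'x) \<times> 'k) \<Rightarrow> real^'k^'p"
  Theta_s_hat  :: "(nat \<Rightarrow> (real^'x) \<times> 'k) \<Rightarrow> real^'k^'p"
  Theta_w2s_hat :: "(nat \<Rightarrow> (real^'x) \<times> 'k) \<Rightarrow> (nat \<Rightarrow> real^'x) \<Rightarrow> real^'k^'p"
  Theta_ls_hat  :: "(nat \<Rightarrow> (real^'x) \<times> 'k) \<Rightarrow> (nat \<Rightarrow> real^'x) \<Rightarrow> real^'k^'p"
  c_mu        :: real
  c_L         :: real
  c_G         :: real
  c_B         :: real
  c_B_Theta   :: real
  c_B_Theta_w :: real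
  c_gamma     :: real
  c_B_eta     :: real
  c_L_H       :: real
  c_B_phi     :: real

definition num_outcomes :: "('d::finite, 'x::finite, 'p::finite, 'k::finite) w2s_problem \<Rightarrow> real" where
  "num_outcomes S = real CARD('k)"

definition context_space :: "('d::finite, 'x::finite, 'p::finite, 'k::finite) w2s_problem \<Rightarrow> (real^'x) measure" where
  "context_space S = restrict_space borel (contexts S)"

definition Dx :: "('d::finite, 'x::finite, 'p::finite, 'k::finite) w2s_problem \<Rightarrow> (real^'x) measure" where
  "Dx S = distr (joint S) (context_space S) fst"

definition labeled :: "('d::finite, 'x::finite, 'p::finite, 'k::finite) w2s_problem \<Rightarrow> (nat \<Rightarrow> (real^'x) \<times> 'k) measure" where
  "labeled S = Pi\<^sub>M {..<n_lab S} (\<lambda>_. joint S)"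

definition unlabeled :: "('d::finite, 'x::finite, 'p::finite, 'k::finite) w2s_problem \<Rightarrow> (nat \<Rightarrow> real^'x) measure" where
  "unlabeled S = Pi\<^sub>M {..<n_unl S} (\<lambda>_. Dx S)"

definition all_data ::
  "('d::finite, 'x::finite, 'p::finite, 'k::finite) w2s_problem \<Rightarrow> ((nat \<Rightarrow> (real^'x) \<times> 'k) \<times> (nat \<Rightarrow> real^'x)) measure" where
  "all_data S = labeled S \<Otimes>\<^sub>M unlabeled S"

definition prob_s :: "('d::finite, 'x::finite, 'p::finite, 'k::finite) w2s_problem \<Rightarrow> real^'k^'p \<Rightarrow> real^'x \<Rightarrow> real^'k" where
  "prob_s S T x = softmax (logits (phi_s S) T x)"

definition prob_w :: "('d::finite, 'x::finite, 'p::finite, 'k::finite) w2s_problem \<Rightarrow> real^'k^'p \<Rightarrow> real^'x \<Rightarrow> real^'k" where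
  "prob_w S T x = softmax (logits (phi_w S) T x)"

definition risk :: "('d::finite, 'x::finite, 'p::finite, 'k::finite) w2s_problem \<Rightarrow> (real^'x \<Rightarrow> real^'d) \<Rightarrow> real" where
  "risk S pol = (\<integral>z. cost S (pol (fst z)) (snd z) \<partial>joint S)"

definition opt_risk :: "('d::finite, 'x::finite, 'p::finite, 'k::finite) w2s_problem \<Rightarrow> real" where
  "opt_risk S = risk S (\<lambda>x. w_opt S (P_star S x))"

definition sum_zero :: "real^'k^'p \<Rightarrow> bool" where
  "sum_zero T \<longleftrightarrow> T *v (\<chi> k. 1) = 0"

definition Sigma_s :: "('d::finite, 'x::finite, 'p::finite, 'k::finite) w2s_problem \<Rightarrow> real^'p^'p" where
  "Sigma_s S = cross_moment (Dx S) (phi_s S) (phi_s S)"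

definition Sigma_w :: "('d::finite, 'x::finite, 'p::finite, 'k::finite) w2s_problem \<Rightarrow> real^'p^'p" where
  "Sigma_w S = cross_moment (Dx S) (phi_w S) (phi_w S)"

definition d_s :: "('d::finite, 'x::finite, 'p::finite, 'k::finite) w2s_problem \<Rightarrow> real" where
  "d_s S = real (rank (Sigma_s S))"

definition d_w :: "('d::finite, 'x::finite, 'p::finite, 'k::finite) w2s_problem \<Rightarrow> real" where
  "d_w S = real (rank (Sigma_w S))"

definition d_sw :: "('d::finite, 'x::finite, 'p::finite, 'k::finite) w2s_problem \<Rightarrow> real" where
  "d_sw S = (norm (spectral_inv_sqrt (rank (Sigma_s S)) (V_s S) (Lam_s S)
                 ** cross_moment (Dx S) (phi_s S) (phi_w S)
                 ** spectral_inv_sqrt (rank (Sigma_w S)) (V_w S) (Lam_w S)))\<^sup>2"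

definition lam_max_w :: "('d::finite, 'x::finite, 'p::finite, 'k::finite) w2s_problem \<Rightarrow> real" where
  "lam_max_w S = diag_max (rank (Sigma_w S)) (Lam_w S)"

definition lam_min_s :: "('d::finite, 'x::finite, 'p::finite, 'k::finite) w2s_problem \<Rightarrow> real" where
  "lam_min_s S = diag_min (rank (Sigma_s S)) (Lam_s S)"


subsection \<open>Objective functions\<close>

definition err_s :: "('d::finite, 'x::finite, 'p::finite, 'k::finite) w2s_problem \<Rightarrow> real^'k^'p \<Rightarrow> real" where
  "err_s S T = (\<integral>x. (norm (logits (phi_s S) T x - eta_star S x))\<^sup>2 \<partial>Dx S)"

definition err_w :: "('d::finite, 'x::finite, 'p::finite, 'k::finite) w2s_problem \<Rightarrow> real^'k^'p \<Rightarrow> real" where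
  "err_w S T = (\<integral>x. (norm (logits (phi_w S) T x - eta_star S x))\<^sup>2 \<partial>Dx S)"

definition neg_log_lik ::
  "('d::finite, 'x::finite, 'p::finite, 'k::finite) w2s_problem \<Rightarrow> (nat \<Rightarrow> (real^'x) \<times> 'k) \<Rightarrow> real^'k^'p \<Rightarrow> real" where
  "neg_log_lik S b T =
     - (1 / real (n_lab S)) * (\<Sum>i<n_lab S. ln (prob_w S T (fst (b i)) $ snd (b i)))"

definition strong_loss ::
  "('d::finite, 'x::finite, 'p::finite, 'k::finite) w2s_problem \<Rightarrow> (nat \<Rightarrow> (real^'x) \<times> 'k) \<Rightarrow> real^'k^'p \<Rightarrow> real" where
  "strong_loss S b T =
     (1 / real (n_lab S)) * (\<Sum>i<n_lab S. cost S (w_opt S (prob_s S T (fst (b i)))) (snd (b i)))"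

definition w2s_loss ::
  "('d::finite, 'x::finite, 'p::finite, 'k::finite) w2s_problem \<Rightarrow> real^'k^'p \<Rightarrow> (nat \<Rightarrow> real^'x) \<Rightarrow> real^'k^'p \<Rightarrow> real" where
  "w2s_loss S W u T =
     (1 / real (n_unl S)) * (\<Sum>j<n_unl S. \<Sum>k\<in>UNIV.
        prob_w S W (u j) $ k * cost S (w_opt S (prob_s S T (u j))) k)"

definition ls_loss ::
  "('d::finite, 'x::finite, 'p::finite, 'k::finite) w2s_problem \<Rightarrow> real^'k^'p \<Rightarrow> (nat \<Rightarrow> real^'x) \<Rightarrow> real^'k^'p \<Rightarrow> real" where
  "ls_loss S W u T =
     (1 / real (n_unl S)) *
       (\<Sum>j<n_unl S. (norm (logits (phi_s S) T (u j) - logits (phi_w S) W (u j)))\<^sup>2)"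


subsection \<open>Standing assumptions\<close>

definition decision_problem :: "('d::finite, 'x::finite, 'p::finite, 'k::finite) w2s_problem \<Rightarrow> bool" where
  "decision_problem S \<longleftrightarrow>
     prob_space (joint S) \<and>
     sets (joint S) = sets (context_space S \<Otimes>\<^sub>M count_space UNIV) \<and>
     phi_s S \<in> borel_measurable (context_space S) \<and>
     phi_w S \<in> borel_measurable (context_space S) \<and>
     P_star S \<in> borel_measurable (context_space S) \<and>
     (\<forall>x\<in>contexts S. P_star S x \<in> prob_vectors) \<and>
     (\<forall>A\<in>sets (context_space S). \<forall>k.
        measure (joint S) (A \<times> {k}) = (LINT x:A|Dx S. P_star S x $ k)) \<and>
     (\<forall>p\<in>prob_vectors.
        is_arg_min (\<lambda>w. \<Sum>k\<in>UNIV. p $ k * cost S w k) (\<lambda>_. True) (w_opt S p)) \<and>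
     n_lab S > 0 \<and> n_unl S > 0 \<and>
     reduced_spectral (Sigma_s S) (V_s S) (Lam_s S) \<and>
     reduced_spectral (Sigma_w S) (V_w S) (Lam_w S) \<and>
     is_arg_min (err_s S) sum_zero (Theta_s_star S) \<and>
     is_arg_min (err_w S) sum_zero (Theta_w_star S)"

definition estimators :: "('d::finite, 'x::finite, 'p::finite, 'k::finite) w2s_problem \<Rightarrow> bool" where
  "estimators S \<longleftrightarrow>
     c_B_Theta S > 0 \<and> c_B S > 0 \<and>
     Theta_w_hat S \<in> borel_measurable (labeled S) \<and>
     Theta_s_hat S \<in> borel_measurable (labeled S) \<and>
     case_prod (Theta_w2s_hat S) \<in> borel_measurable (all_data S) \<and>
     case_prod (Theta_ls_hat S) \<in> borel_measurable (all_data S) \<and>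
     (AE b in labeled S.
        is_arg_min (neg_log_lik S b) (\<lambda>T. sum_zero T \<and> norm T \<le> c_B_Theta S) (Theta_w_hat S b)) \<and>
     (AE b in labeled S. norm (Theta_w_hat S b) \<le> c_B_Theta_w S) \<and>
     (AE z in all_data S.
        is_arg_min (w2s_loss S (Theta_w_hat S (fst z)) (snd z)) (\<lambda>T. norm T \<le> c_B S)
          (Theta_w2s_hat S (fst z) (snd z))) \<and>
     (AE z in all_data S.
        is_arg_min (ls_loss S (Theta_w_hat S (fst z)) (snd z)) (\<lambda>_. True)
          (Theta_ls_hat S (fst z) (snd z))) \<and>
     (AE b in labeled S. is_arg_min (strong_loss S b) sum_zero (Theta_s_hat S b))"


subsection \<open>Derived quantities\<close>

text \<open>The infima below are attained at the minimisers fixed in the setting.\<close>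

definition rho_s :: "('d::finite, 'x::finite, 'p::finite, 'k::finite) w2s_problem \<Rightarrow> real" where
  "rho_s S = (INF T\<in>{T. sum_zero T}. err_s S T)"

definition rho_w :: "('d::finite, 'x::finite, 'p::finite, 'k::finite) w2s_problem \<Rightarrow> real" where
  "rho_w S = (INF T\<in>{T. sum_zero T}. err_w S T)"

definition rho_sw :: "('d::finite, 'x::finite, 'p::finite, 'k::finite) w2s_problem \<Rightarrow> real^'k^'p \<Rightarrow> real" where
  "rho_sw S W = (INF T\<in>{T. norm T \<le> c_B S}.
     \<integral>x. (norm (logits (phi_s S) T x - logits (phi_w S) W x))\<^sup>2 \<partial>Dx S)"

definition mu_w :: "('d::finite, 'x::finite, 'p::finite, 'k::finite) w2s_problem \<Rightarrow> real" where
  "mu_w S = exp (- 2 * c_B_Theta S * c_B_phi S) / num_outcomes S * lambda_min (Sigma_w S)"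

definition Sigma_grad :: "('d::finite, 'x::finite, 'p::finite, 'k::finite) w2s_problem \<Rightarrow> real^('p \<times> 'k)^('p \<times> 'k)" where
  "Sigma_grad S = covariance_matrix (joint S) (\<lambda>z. vectorise
     (grad (\<lambda>T. cost S (w_opt S (prob_s S T (fst z))) (snd z)) (Theta_s_star S)))"

definition C_unif :: "('d::finite, 'x::finite, 'p::finite, 'k::finite) w2s_problem \<Rightarrow> real" where
  "C_unif S = Max (range (\<lambda>k. \<bar>cost S (w_opt S (softmax 0)) k\<bar>))"

definition coef_1 :: "('d::finite, 'x::finite, 'p::finite, 'k::finite) w2s_problem \<Rightarrow> real" where
  "coef_1 S = c_L S * num_outcomes S * (c_G S)\<^sup>2 / (c_mu S)\<^sup>2"

definition coef_2 :: "('d::finite, 'x::finite, 'p::finite, 'k::finite) w2s_problem \<Rightarrow> real" where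
  "coef_2 S = (c_L S)\<^sup>2 * num_outcomes S * (c_G S)\<^sup>2 / (c_mu S) ^ 3 + coef_1 S"

definition weak_mse :: "('d::finite, 'x::finite, 'p::finite, 'k::finite) w2s_problem \<Rightarrow> real" where
  "weak_mse S = (\<integral>b. (norm (Theta_w_hat S b - Theta_w_star S))\<^sup>2 \<partial>labeled S)"

definition E_imit :: "('d::finite, 'x::finite, 'p::finite, 'k::finite) w2s_problem \<Rightarrow> real" where
  "E_imit S = coef_2 S * (\<integral>b. rho_sw S (Theta_w_hat S b) \<partial>labeled S)"

definition E_approx :: "('d::finite, 'x::finite, 'p::finite, 'k::finite) w2s_problem \<Rightarrow> real" where
  "E_approx S = coef_1 S * (rho_w S + rho_s S)"

definition E_teacher :: "('d::finite, 'x::finite, 'p::finite, 'k::finite) w2s_problem \<Rightarrow> real" where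
  "E_teacher S = coef_1 S * lam_max_w S * weak_mse S *
     (d_sw S + 1 / real (n_unl S) * d_s S * (d_w S - d_sw S))"

definition C_t :: "('d::finite, 'x::finite, 'p::finite, 'k::finite) w2s_problem \<Rightarrow> real" where
  "C_t S = 4 * c_L S * num_outcomes S * (c_G S)\<^sup>2 / ((c_mu S)\<^sup>2 * (mu_w S)\<^sup>2)
             * lam_max_w S * trace (Sigma_w S)"

definition C_N :: "('d::finite, 'x::finite, 'p::finite, 'k::finite) w2s_problem \<Rightarrow> real" where
  "C_N S =
     coef_2 S *
       ((c_B_Theta_w S)\<^sup>2 * sqrt (\<integral>x. norm (phi_w S x) ^ 4 \<partial>Dx S)
        + (c_B S)\<^sup>2 * sqrt (\<integral>x. norm (phi_s S x) ^ 4 \<partial>Dx S)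
        + c_B S * c_B_Theta_w S *
            sqrt (\<integral>x. (norm (phi_s S x))\<^sup>2 * (norm (phi_w S x))\<^sup>2 \<partial>Dx S))
     + coef_1 S *
       (sqrt (\<integral>x. norm (eta_star S x) ^ 4 \<partial>Dx S)
        + c_B S * sqrt (trace (Sigma_s S))
        + c_B S * root 4 (\<integral>x. norm (eta_star S x) ^ 4 \<partial>Dx S)
                * root 4 (\<integral>x. norm (phi_s S x) ^ 4 \<partial>Dx S))
     + c_L S * C_unif S / c_mu S"

text \<open>The right-hand side of the strong-only lower bound, without its universal constant.\<close>

definition strong_lower :: "('d::finite, 'x::finite, 'p::finite, 'k::finite) w2s_problem \<Rightarrow> real" where
  "strong_lower S = c_mu S * (c_gamma S)\<^sup>2 * (exp (- 4 * c_B_eta S) / (num_outcomes S)\<^sup>2) *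
     (rho_s S + lam_min_s S * trace (Sigma_grad S) / ((c_L_H S)\<^sup>2 * real (n_lab S)))"

definition M_n :: "('d::finite, 'x::finite, 'p::finite, 'k::finite) w2s_problem \<Rightarrow> real" where
  "M_n S = strong_lower S - E_imit S - E_approx S - C_t S * d_sw S / real (n_lab S)"

definition excess_w2s :: "('d::finite, 'x::finite, 'p::finite, 'k::finite) w2s_problem \<Rightarrow> real" where
  "excess_w2s S = (\<integral>z. (risk S (\<lambda>x. w_opt S (prob_s S (Theta_w2s_hat S (fst z) (snd z)) x))
                          - opt_risk S) \<partial>all_data S)"

definition excess_s :: "('d::finite, 'x::finite, 'p::finite, 'k::finite) w2s_problem \<Rightarrow> real" where
  "excess_s S = (\<integral>b. (risk S (\<lambda>x. w_opt S (prob_s S (Theta_s_hat S b) x))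
                        - opt_risk S) \<partial>labeled S)"


subsection \<open>Hypotheses\<close>

definition A1 :: "('d::finite, 'x::finite, 'p::finite, 'k::finite) w2s_problem \<Rightarrow> bool" where
  "A1 S \<longleftrightarrow>
     eta_star S \<in> borel_measurable (context_space S) \<and>
     (\<forall>x\<in>contexts S. P_star S x = softmax (eta_star S x) \<and> (\<Sum>k\<in>UNIV. eta_star S x $ k) = 0) \<and>
     integrable (Dx S) (\<lambda>x. norm (eta_star S x) ^ 4)"

definition A2 :: "('d::finite, 'x::finite, 'p::finite, 'k::finite) w2s_problem \<Rightarrow> bool" where
  "A2 S \<longleftrightarrow>
     c_mu S > 0 \<and>
     (\<forall>a k. hess_between (\<lambda>a. cost S a k) a (c_mu S) (c_L S)) \<and>
     (\<forall>k. \<forall>a\<in>convex hull (w_opt S ` prob_vectors). norm (grad (\<lambda>a. cost S a k) a) \<le> c_G S)"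

definition A3 :: "('d::finite, 'x::finite, 'p::finite, 'k::finite) w2s_problem \<Rightarrow> bool" where
  "A3 S \<longleftrightarrow> (AE z in all_data S. norm (Theta_ls_hat S (fst z) (snd z)) \<le> c_B S)"

text \<open>Integrability is demanded explicitly because the Bochner integral of a non-integrable
  function is 0.\<close>

definition A4 :: "('d::finite, 'x::finite, 'p::finite, 'k::finite) w2s_problem \<Rightarrow> bool" where
  "A4 S \<longleftrightarrow>
     (let phi = (\<lambda>x. stack (phi_s S x) (phi_w S x)); Sig = covariance_matrix (Dx S) phi in
      \<exists>\<kappa>>0. \<forall>u. integrable (Dx S) (\<lambda>x. exp (u \<bullet> phi x)) \<and>
        (\<integral>x. exp (u \<bullet> phi x) \<partial>Dx S) \<le> exp (1 / 2 * \<kappa>\<^sup>2 * (u \<bullet> (Sig *v u))))"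

definition A5 :: "('d::finite, 'x::finite, 'p::finite, 'k::finite) w2s_problem \<Rightarrow> bool" where
  "A5 S \<longleftrightarrow>
     c_gamma S > 0 \<and> c_B_eta S > 0 \<and>
     (\<forall>x\<in>contexts S. AE b in labeled S.
        norm (w_opt S (prob_s S (Theta_s_hat S b) x) - w_opt S (P_star S x))
          \<ge> c_gamma S * norm (prob_s S (Theta_s_hat S b) x - P_star S x)) \<and>
     (\<forall>x\<in>contexts S. AE b in labeled S. infnorm (logits (phi_s S) (Theta_s_hat S b) x) \<le> c_B_eta S) \<and>
     (\<forall>x\<in>contexts S. infnorm (eta_star S x) \<le> c_B_eta S)"

definition A6 :: "('d::finite, 'x::finite, 'p::finite, 'k::finite) w2s_problem \<Rightarrow> bool" where
  "A6 S \<longleftrightarrow>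
     c_L_H S > 0 \<and>
     (AE b in labeled S. \<forall>T\<in>closed_segment (Theta_s_star S) (Theta_s_hat S b).
        hess_between (strong_loss S b) T (- c_L_H S) (c_L_H S))"

definition A7 :: "('d::finite, 'x::finite, 'p::finite, 'k::finite) w2s_problem \<Rightarrow> bool" where
  "A7 S \<longleftrightarrow>
     rho_w S = 0 \<and>
     (\<forall>T. is_arg_min (err_w S) sum_zero T \<longrightarrow> T = Theta_w_star S) \<and>
     norm (Theta_w_star S) < c_B_Theta S"

definition A8 :: "('d::finite, 'x::finite, 'p::finite, 'k::finite) w2s_problem \<Rightarrow> bool" where
  "A8 S \<longleftrightarrow> c_B_phi S > 0 \<and> (\<forall>x\<in>contexts S. norm (phi_w S x) \<le> c_B_phi S)"

end

theory Submission
  imports Defs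
begin

text \<open>Combining (W) with condition (i) bounds the teacher term by (1 + c_i) times C_t / n (d_sw +
  d_s (d_w - d_sw) / N), so it remains to absorb C_N / sqrt N and D / N, with
  D = C_t d_s (d_w - d_sw) / n, into M_n. The threshold in (iii) is the square of the positive root
  of M_n s^2 - C_N s - D = 0, whence C_N / sqrt N + D / N is at most M_n up to max 1 (1 / c_iii).
  All signs are elementary except d_sw <= d_w, which is Bessel's inequality in L^2 for the
  whitened features.\<close>

section \<open>Bessel's inequality for integrals\<close>

lemma sum_mult_integral_expand:
  fixes a :: "'i \<Rightarrow> real" and h :: "'i \<Rightarrow> 'a \<Rightarrow> real"
  assumes "\<And>i. i \<in> I \<Longrightarrow> integrable M (h i)"
  shows "integrable M (\<lambda>x. \<Sum>i\<in>I. a i * h i x)"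
    and "(\<integral>x. (\<Sum>i\<in>I. a i * h i x) \<partial>M) = (\<Sum>i\<in>I. a i * (\<integral>x. h i x \<partial>M))"
  using assms by (auto simp: Bochner_Integration.integral_sum)

text \<open>The residual of \<open>g\<close> after projection onto the orthonormal family has a
  nonnegative squared integral. Integrability is assumed for products only, which is what the
  expanded square is made of.\<close>

lemma integral_Bessel_inequality:
  fixes f :: "'i \<Rightarrow> 'a \<Rightarrow> real" and g :: "'a \<Rightarrow> real"
  assumes "finite I"
    and gg: "integrable M (\<lambda>x. g x * g x)"
    and fg: "\<And>i. i \<in> I \<Longrightarrow> integrable M (\<lambda>x. f i x * g x)"
    and ff: "\<And>i j. i \<in> I \<Longrightarrow> j \<in> I \<Longrightarrow> integrable M (\<lambda>x. f i x * f j x)"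
    and orth: "\<And>i j. i \<in> I \<Longrightarrow> j \<in> I \<Longrightarrow>
      (\<integral>x. f i x * f j x \<partial>M) = (if i = j then 1 else 0)"
  shows "(\<Sum>i\<in>I. (\<integral>x. f i x * g x \<partial>M)\<^sup>2) \<le> (\<integral>x. g x * g x \<partial>M)"
proof -
  define a where "a i = (\<integral>x. f i x * g x \<partial>M)" for i
  have expand: "(g x - (\<Sum>i\<in>I. a i * f i x))\<^sup>2
      = g x * g x - 2 * (\<Sum>i\<in>I. a i * (f i x * g x))
        + (\<Sum>i\<in>I. a i * (\<Sum>j\<in>I. a j * (f i x * f j x)))" for x
    by (simp add: power2_diff power2_eq_square sum_product sum_distrib_left sum_distrib_right
        algebra_simps)
  have i1: "integrable M (\<lambda>x. \<Sum>i\<in>I. a i * (f i x * g x))"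
    and e1: "(\<integral>x. (\<Sum>i\<in>I. a i * (f i x * g x)) \<partial>M) = (\<Sum>i\<in>I. a i * a i)"
    using sum_mult_integral_expand[of I M "\<lambda>i x. f i x * g x" a] fg by (auto simp: a_def)
  have i2: "integrable M (\<lambda>x. \<Sum>j\<in>I. a j * (f i x * f j x))"
    and e2: "(\<integral>x. (\<Sum>j\<in>I. a j * (f i x * f j x)) \<partial>M) = a i" if "i \<in> I" for i
  proof -
    show "integrable M (\<lambda>x. \<Sum>j\<in>I. a j * (f i x * f j x))"
      using sum_mult_integral_expand(1)[of I M "\<lambda>j x. f i x * f j x" a] ff that by auto
    have "(\<integral>x. (\<Sum>j\<in>I. a j * (f i x * f j x)) \<partial>M) = (\<Sum>j\<in>I. a j * (if i = j then 1 else 0))"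
      using sum_mult_integral_expand(2)[of I M "\<lambda>j x. f i x * f j x" a] ff that orth by auto
    also have "\<dots> = a i"
      using that \<open>finite I\<close> by (simp add: if_distrib cong: if_cong)
    finally show "(\<integral>x. (\<Sum>j\<in>I. a j * (f i x * f j x)) \<partial>M) = a i" .
  qed
  \<comment> \<open>Orthonormality reduces the quadratic term to the sum of
    \<open>a i * a i\<close>. The cross term contributes the same sum with weight -2, so one
    negative copy survives.\<close>
  have i3: "integrable M (\<lambda>x. \<Sum>i\<in>I. a i * (\<Sum>j\<in>I. a j * (f i x * f j x)))"
    and e3: "(\<integral>x. (\<Sum>i\<in>I. a i * (\<Sum>j\<in>I. a j * (f i x * f j x))) \<partial>M) = (\<Sum>i\<in>I. a i * a i)"
    using sum_mult_integral_expand[of I M "\<lambda>i x. \<Sum>j\<in>I. a j * (f i x * f j x)" a] i2 e2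
    by auto
  have "0 \<le> (\<integral>x. (g x - (\<Sum>i\<in>I. a i * f i x))\<^sup>2 \<partial>M)"
    by simp
  also have "\<dots> = (\<integral>x. g x * g x \<partial>M) - (\<Sum>i\<in>I. a i * a i)"
    unfolding expand using gg i1 i3 by (simp add: e1 e3)
  finally show ?thesis
    by (simp add: a_def power2_eq_square)
qed

section \<open>Bilinear forms of moment matrices and spectral decompositions\<close>

lemma inner_vec_real: "u \<bullet> v = (\<Sum>i\<in>UNIV. u $ i * (v :: real^'n) $ i)"
  by (simp add: inner_vec_def)

text \<open>Translates matrix expressions in \<open>cross_moment\<close> into L^2 inner products of
  linear functionals of the features, the form in which Bessel's inequality applies.\<close>

lemma integral_inner_mult_inner:
  fixes f :: "'a \<Rightarrow> real^'p" and g :: "'a \<Rightarrow> real^'q"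
  assumes "\<And>i j. integrable M (\<lambda>x. f x $ i * g x $ j)"
  shows "integrable M (\<lambda>x. (u \<bullet> f x) * (v \<bullet> g x))"
    and "(\<integral>x. (u \<bullet> f x) * (v \<bullet> g x) \<partial>M) = u \<bullet> (cross_moment M f g *v v)"
proof -
  have eq: "(u \<bullet> f x) * (v \<bullet> g x) = (\<Sum>i\<in>UNIV. u $ i * (\<Sum>j\<in>UNIV. v $ j * (f x $ i * g x $ j)))" for x
    by (simp add: inner_vec_real sum_product sum_distrib_left algebra_simps) (rule sum.swap)
  have i1: "integrable M (\<lambda>x. \<Sum>j\<in>UNIV. v $ j * (f x $ i * g x $ j))" for i
    using assms by auto
  show "integrable M (\<lambda>x. (u \<bullet> f x) * (v \<bullet> g x))"
    unfolding eq using i1 by auto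
  show "(\<integral>x. (u \<bullet> f x) * (v \<bullet> g x) \<partial>M) = u \<bullet> (cross_moment M f g *v v)"
    unfolding eq using i1 assms
    by (simp add: inner_vec_real matrix_vector_mult_def cross_moment_def mult.commute)
qed

text \<open>By orthonormality of the columns, \<open>V j\<close> is an eigenvector of
  \<open>A\<close> for \<open>lam j\<close>. Dividing the columns by \<open>sqrt (lam j)\<close>
  therefore makes them orthonormal for the form of \<open>A\<close>, which is the whitening.\<close>

lemma reduced_spectral_bilinear:
  assumes "reduced_spectral A V lam" "i < rank A" "j < rank A"
  shows "V i \<bullet> (A *v V j) = (if i = j then lam i else 0)"
proof -
  have V: "V a \<bullet> V b = (if a = b then 1 else 0)" if "a < rank A" "b < rank A" for a b
    using assms(1) that by (auto simp: reduced_spectral_def)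
  have A: "A $ a $ b = (\<Sum>k<rank A. lam k * V k $ a * V k $ b)" for a b
  proof -
    have "A = (\<chi> a b. \<Sum>k<rank A. lam k * V k $ a * V k $ b)"
      using assms(1) by (simp add: reduced_spectral_def)
    then show ?thesis
      by (metis (no_types, lifting) vec_lambda_beta)
  qed
  have "A *v V j = (\<Sum>k<rank A. (lam k * (V k \<bullet> V j)) *\<^sub>R V k)"
    by (simp add: vec_eq_iff matrix_vector_mult_def A inner_vec_real sum_distrib_left
        sum_distrib_right mult_ac)
      (intro allI sum.swap)
  also have "\<dots> = (\<Sum>k<rank A. if k = j then lam k *\<^sub>R V k else 0)"
    by (rule sum.cong) (use V assms(3) in auto)
  also have "\<dots> = lam j *\<^sub>R V j"
    using assms(3) by simp
  finally show ?thesis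
    using V assms by auto
qed

section \<open>Frobenius norm of a whitened matrix\<close>

definition outer_product :: "real^'p \<Rightarrow> real^'q \<Rightarrow> real^'q^'p" where
  "outer_product u v = (\<chi> a b. u $ a * v $ b)"

text \<open>Since \<open>\<bullet>\<close> on matrices is the Frobenius inner product, outer
  products of two orthonormal families are again orthonormal.\<close>

lemma inner_outer_product: "outer_product u v \<bullet> outer_product w z = (u \<bullet> w) * (v \<bullet> z)"
  by (simp add: outer_product_def inner_vec_def sum_product mult_ac) (rule sum.swap)

lemma sum_mult_sum_swap:
  fixes X :: "'i \<Rightarrow> 'c \<Rightarrow> real"
  shows "(\<Sum>c\<in>C. (\<Sum>i\<in>I. X i c) * (\<Sum>j\<in>J. Y j c)) = (\<Sum>i\<in>I. \<Sum>j\<in>J. \<Sum>c\<in>C. X i c * Y j c)"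
  unfolding sum_product by (subst sum.swap) (rule sum.cong[OF refl sum.swap])

text \<open>Both inverse square roots are sums of rank-one matrices; in the product the inner
  vectors contract with \<open>C\<close> to a scalar and the outer vectors remain. This gives the
  coordinates of the whitened matrix with respect to the outer products.\<close>

lemma spectral_inv_sqrt_sandwich:
  "spectral_inv_sqrt r V lam ** C ** spectral_inv_sqrt s W nu =
    (\<Sum>(i, j)\<in>{..<r} \<times> {..<s}.
      (1 / sqrt (lam i) * (1 / sqrt (nu j)) * (V i \<bullet> (C *v W j))) *\<^sub>R outer_product (V i) (W j))"
proof -
  \<comment> \<open>\<open>P\<close> and \<open>Q\<close> attach the inverse square root weights to
    the outer vectors, which keeps the inner vectors free for the contraction with
    \<open>C\<close>.\<close>
  define P where "P i a = 1 / sqrt (lam i) * V i $ a" for i a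
  define Q where "Q j b = 1 / sqrt (nu j) * W j $ b" for j b
  have l: "(spectral_inv_sqrt r V lam ** C) $ a $ c
      = (\<Sum>i<r. P i a * (\<Sum>d\<in>UNIV. V i $ d * C $ d $ c))" for a c
    unfolding matrix_matrix_mult_def spectral_inv_sqrt_def P_def
    by (simp add: sum_distrib_left sum_distrib_right mult_ac) (rule sum.swap)
  have "(spectral_inv_sqrt r V lam ** C ** spectral_inv_sqrt s W nu) $ a $ b
      = (\<Sum>c\<in>UNIV. (\<Sum>i<r. P i a * (\<Sum>d\<in>UNIV. V i $ d * C $ d $ c)) * (\<Sum>j<s. Q j b * W j $ c))"
    for a b
    using l[of a]
    by (simp add: matrix_matrix_mult_def[of "spectral_inv_sqrt r V lam ** C"]
        spectral_inv_sqrt_def[of s] Q_def mult_ac)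
  also have "\<dots> a b = (\<Sum>i<r. \<Sum>j<s. \<Sum>c\<in>UNIV. P i a * (\<Sum>d\<in>UNIV. V i $ d * C $ d $ c) * (Q j b * W j $ c))"
    for a b
    by (rule sum_mult_sum_swap)
  also have "\<dots> a b = (\<Sum>i<r. \<Sum>j<s. P i a * Q j b * (V i \<bullet> (C *v W j)))" for a b
    by (intro sum.cong refl, simp add: inner_vec_real matrix_vector_mult_def sum_distrib_left
        sum_distrib_right mult_ac) (rule sum.swap)
  finally show ?thesis
    by (simp add: vec_eq_iff outer_product_def sum.cartesian_product[symmetric] P_def Q_def mult_ac)
qed

text \<open>Pythagoras for the orthonormal outer products. The sum over \<open>i\<close> is placed
  inside because Bessel's inequality is applied later with \<open>j\<close> fixed.\<close>

lemma norm_spectral_inv_sqrt_sandwich: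
  assumes V: "\<And>i k. i < r \<Longrightarrow> k < r \<Longrightarrow> V i \<bullet> V k = (if i = k then 1 else 0)"
    and W: "\<And>i k. i < s \<Longrightarrow> k < s \<Longrightarrow> W i \<bullet> W k = (if i = k then 1 else 0)"
  shows "(norm (spectral_inv_sqrt r V lam ** C ** spectral_inv_sqrt s W nu))\<^sup>2 =
    (\<Sum>j<s. \<Sum>i<r. (1 / sqrt (lam i) * (1 / sqrt (nu j)) * (V i \<bullet> (C *v W j)))\<^sup>2)"
proof -
  define h where "h = (\<lambda>(i, j). (1 / sqrt (lam i) * (1 / sqrt (nu j)) * (V i \<bullet> (C *v W j)))
    *\<^sub>R outer_product (V i) (W j))"
  have n: "norm (outer_product (V i) (W j)) = 1" if "i < r" "j < s" for i j
    using V W that by (simp add: norm_eq_sqrt_inner inner_outer_product)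
  have "pairwise (\<lambda>p q. orthogonal (h p) (h q)) ({..<r} \<times> {..<s})"
    using V W by (auto simp: pairwise_def orthogonal_def h_def inner_outer_product)
  then have "(norm (sum h ({..<r} \<times> {..<s})))\<^sup>2 = (\<Sum>p\<in>{..<r} \<times> {..<s}. (norm (h p))\<^sup>2)"
    by (intro norm_sum_Pythagorean) auto
  also have "\<dots> = (\<Sum>(i, j)\<in>{..<r} \<times> {..<s}. (1 / sqrt (lam i) * (1 / sqrt (nu j)) * (V i \<bullet> (C *v W j)))\<^sup>2)"
    by (rule sum.cong) (use n in \<open>auto simp: h_def power_divide\<close>)
  also have "\<dots> = (\<Sum>j<s. \<Sum>i<r. (1 / sqrt (lam i) * (1 / sqrt (nu j)) * (V i \<bullet> (C *v W j)))\<^sup>2)"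
    by (subst sum.swap) (rule sum.cartesian_product[symmetric])
  finally show ?thesis
    by (simp add: spectral_inv_sqrt_sandwich h_def)
qed

text \<open>The squared norm is the sum of squared L^2 inner products of the whitened features
  \<open>F i\<close> and \<open>H j\<close>. The \<open>F i\<close> are orthonormal and each
  \<open>H j\<close> has norm 1, so by Bessel every \<open>j\<close> contributes at most 1.\<close>

lemma norm_whitened_cross_moment_le:
  fixes f :: "'a \<Rightarrow> real^'p" and g :: "'a \<Rightarrow> real^'q"
  assumes A: "reduced_spectral (cross_moment M f f) V lam"
    and B: "reduced_spectral (cross_moment M g g) W nu"
    and ff: "\<And>i j. integrable M (\<lambda>x. f x $ i * f x $ j)"
    and gg: "\<And>i j. integrable M (\<lambda>x. g x $ i * g x $ j)"
    and fg: "\<And>i j. integrable M (\<lambda>x. f x $ i * g x $ j)"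
  shows "(norm (spectral_inv_sqrt (rank (cross_moment M f f)) V lam ** cross_moment M f g
      ** spectral_inv_sqrt (rank (cross_moment M g g)) W nu))\<^sup>2 \<le> real (rank (cross_moment M g g))"
proof -
  let ?A = "cross_moment M f f" and ?B = "cross_moment M g g" and ?C = "cross_moment M f g"
  define F where "F i x = ((1 / sqrt (lam i)) *\<^sub>R V i) \<bullet> f x" for i x
  define H where "H j x = ((1 / sqrt (nu j)) *\<^sub>R W j) \<bullet> g x" for j x
  note FF = integral_inner_mult_inner[OF ff] and HH = integral_inner_mult_inner[OF gg]
    and FH = integral_inner_mult_inner[OF fg]
  have orth: "(\<integral>x. F i x * F j x \<partial>M) = (if i = j then 1 else 0)" if "i < rank ?A" "j < rank ?A" for i j
    using reduced_spectral_bilinear[OF A that] A that unfolding F_def FF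
    by (auto simp: matrix_vector_mult_scaleR reduced_spectral_def)
  have unit: "(\<integral>x. H j x * H j x \<partial>M) = 1" if "j < rank ?B" for j
    using reduced_spectral_bilinear[OF B that that] B that unfolding H_def HH
    by (auto simp: matrix_vector_mult_scaleR reduced_spectral_def)
  have "(\<Sum>i<rank ?A. (1 / sqrt (lam i) * (1 / sqrt (nu j)) * (V i \<bullet> (?C *v W j)))\<^sup>2) \<le> 1"
    if "j < rank ?B" for j
  proof -
    have "(\<Sum>i<rank ?A. (\<integral>x. F i x * H j x \<partial>M)\<^sup>2) \<le> (\<integral>x. H j x * H j x \<partial>M)"
      by (rule integral_Bessel_inequality) (use orth in \<open>auto simp: F_def H_def intro: FF HH FH simp del: inner_scaleR_left\<close>)
    then show ?thesis
      unfolding unit[OF that] unfolding F_def H_def FH by (simp add: matrix_vector_mult_scaleR mult_ac)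
  qed
  then have "(\<Sum>j<rank ?B. \<Sum>i<rank ?A. (1 / sqrt (lam i) * (1 / sqrt (nu j)) * (V i \<bullet> (?C *v W j)))\<^sup>2)
      \<le> (\<Sum>j<rank ?B. 1)"
    by (intro sum_mono) auto
  moreover have "(norm (spectral_inv_sqrt (rank ?A) V lam ** ?C ** spectral_inv_sqrt (rank ?B) W nu))\<^sup>2
      = (\<Sum>j<rank ?B. \<Sum>i<rank ?A. (1 / sqrt (lam i) * (1 / sqrt (nu j)) * (V i \<bullet> (?C *v W j)))\<^sup>2)"
    by (rule norm_spectral_inv_sqrt_sandwich) (use A B in \<open>auto simp: reduced_spectral_def\<close>)
  ultimately show ?thesis
    by simp
qed

section \<open>Second moments from exponential moments\<close>

lemma borel_measurable_vec_nth:
  "f \<in> borel_measurable M \<Longrightarrow> (\<lambda>x. (f x :: real^'n) $ k) \<in> borel_measurable M"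
  using borel_measurable_inner[of f M "\<lambda>_. axis k 1"] by (simp add: inner_axis)

text \<open>For s \<ge> 0 the Taylor bound 1 + s + s^2/2 \<le> exp s supplies the square and
  explains the factor 2; the right-hand side is even, which covers negative arguments.\<close>

lemma square_le_exp_plus_exp_minus: "(t::real)\<^sup>2 \<le> 2 * (exp t + exp (- t))"
proof -
  have *: "s\<^sup>2 \<le> 2 * (exp s + exp (- s))" if "s \<ge> 0" for s :: real
    using exp_lower_Taylor_quadratic[OF that] exp_ge_add_one_self[of "- s"] that by simp
  show ?thesis
    using *[of t] *[of "- t"] by (cases "t \<ge> 0") (auto simp: add.commute)
qed

text \<open>Squares of coordinates are dominated by exponential moments in the directions
  \<open>axis k 1\<close> and \<open>- axis k 1\<close>, and mixed products by sums of two
  squares.\<close>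

lemma integrable_mult_of_exp_moments:
  fixes f :: "'a \<Rightarrow> real^'n"
  assumes f: "f \<in> borel_measurable M" and e: "\<And>u. integrable M (\<lambda>x. exp (u \<bullet> f x))"
  shows "integrable M (\<lambda>x. f x $ i * f x $ j)"
proof -
  have m: "(\<lambda>x. f x $ k) \<in> borel_measurable M" for k
    using f by (simp add: borel_measurable_vec_nth)
  have sq: "integrable M (\<lambda>x. (f x $ k)\<^sup>2)" for k
  proof (rule Bochner_Integration.integrable_bound)
    show "integrable M (\<lambda>x. 2 * (exp (axis k 1 \<bullet> f x) + exp (- axis k 1 \<bullet> f x)))"
      using e[of "axis k 1"] e[of "- axis k 1"] by auto
    show "AE x in M. norm ((f x $ k)\<^sup>2) \<le> norm (2 * (exp (axis k 1 \<bullet> f x) + exp (- axis k 1 \<bullet> f x)))"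
      using square_le_exp_plus_exp_minus by (auto simp: inner_axis' abs_of_pos add_pos_pos)
  qed (use m in measurable)
  show ?thesis
  proof (rule Bochner_Integration.integrable_bound)
    show "integrable M (\<lambda>x. (f x $ i)\<^sup>2 + (f x $ j)\<^sup>2)"
      using sq by auto
    have "\<bar>a * b\<bar> \<le> a\<^sup>2 + b\<^sup>2" for a b :: real
    proof -
      have "0 \<le> \<bar>a\<bar> * \<bar>b\<bar>"
        by simp
      then show ?thesis
        using sum_squares_bound[of "\<bar>a\<bar>" "\<bar>b\<bar>"] unfolding abs_mult power2_abs by linarith
    qed
    then show "AE x in M. norm (f x $ i * f x $ j) \<le> norm ((f x $ i)\<^sup>2 + (f x $ j)\<^sup>2)"
      by auto
  qed (use m in measurable)
qed

lemma stack_nth [simp]: "stack u v $ Inl a = u $ a" "stack u v $ Inr b = v $ b"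
  by (simp_all add: stack_def)

lemma borel_measurable_stack:
  fixes f :: "'a \<Rightarrow> real^'p" and g :: "'a \<Rightarrow> real^'q"
  assumes "f \<in> borel_measurable M" "g \<in> borel_measurable M"
  shows "(\<lambda>x. stack (f x) (g x)) \<in> borel_measurable M"
proof -
  have "(\<lambda>x. stack (f x) (g x) \<bullet> b) \<in> borel_measurable M" if "b \<in> Basis" for b :: "real^('p + 'q)"
  proof -
    from that obtain k where b: "b = axis k 1"
      by (auto simp: Basis_vec_def)
    show ?thesis
      using assms by (cases k) (auto simp: b inner_axis borel_measurable_vec_nth)
  qed
  then show ?thesis
    by (simp add: borel_measurable_euclidean_space[where f = "\<lambda>x. stack (f x) (g x)"])
qed

text \<open>(A4) concerns the stacked features, so one integrability result covers the strong, weak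
  and mixed products, read off at \<open>Inl\<close> and \<open>Inr\<close> indices. The inequality
  gives the factor \<open>d_w S - d_sw S\<close> in the teacher term its sign.\<close>

lemma d_sw_le_d_w:
  assumes "decision_problem S" "A4 S"
  shows "d_sw S \<le> d_w S"
proof -
  have m: "phi_s S \<in> borel_measurable (Dx S)" "phi_w S \<in> borel_measurable (Dx S)"
    using assms(1) by (auto simp: decision_problem_def Dx_def)
  have "integrable (Dx S) (\<lambda>x. exp (u \<bullet> stack (phi_s S x) (phi_w S x)))" for u
    using assms(2) by (auto simp: A4_def Let_def)
  note * = integrable_mult_of_exp_moments[OF borel_measurable_stack[OF m] this]
  have "integrable (Dx S) (\<lambda>x. phi_s S x $ i * phi_s S x $ j)"
    "integrable (Dx S) (\<lambda>x. phi_w S x $ i * phi_w S x $ j)"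
    "integrable (Dx S) (\<lambda>x. phi_s S x $ i * phi_w S x $ j)" for i j
    using *[of "Inl i" "Inl j"] *[of "Inr i" "Inr j"] *[of "Inl i" "Inr j"] by auto
  then show ?thesis
    using assms(1) unfolding d_sw_def d_w_def Sigma_s_def Sigma_w_def
    by (intro norm_whitened_cross_moment_le) (auto simp: decision_problem_def Sigma_s_def Sigma_w_def)
qed

section \<open>Signs of the constants and error terms\<close>

lemma trace_cross_moment_nonneg: "0 \<le> trace (cross_moment M f f)"
  by (simp add: trace_def cross_moment_def sum_nonneg)

lemma lam_max_w_nonneg:
  assumes "decision_problem S"
  shows "0 \<le> lam_max_w S"
proof (cases "rank (Sigma_w S) = 0")
  \<comment> \<open>With positive rank the index 0 carries a positive entry; in rank 0 the default
    value 0 of \<open>diag_max\<close> settles the claim.\<close>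
  case False
  have "0 < Lam_w S 0"
    using assms False by (auto simp: decision_problem_def reduced_spectral_def)
  also have "\<dots> \<le> Max (Lam_w S ` {..<rank (Sigma_w S)})"
    using False by (intro Max_ge) auto
  finally show ?thesis
    using False by (simp add: lam_max_w_def diag_max_def)
qed (simp add: lam_max_w_def diag_max_def)

text \<open>(A2) gives a sign to \<open>c_mu S\<close> only. Testing both Hessian bounds on a unit
  vector, which exists because the index type is nonempty, yields
  \<open>c_mu S \<le> c_L S\<close>.\<close>

lemma A2_c_L_pos:
  assumes "A2 (S :: ('d::finite, 'x::finite, 'p::finite, 'k::finite) w2s_problem)"
  shows "0 < c_L S"
proof -
  obtain h :: "real^'d" where "norm h = 1"
    using vector_choose_size[of 1] by auto
  then have "h \<bullet> h = 1"
    by (simp add: norm_eq_1)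
  moreover have "hess_between (\<lambda>a. cost S a k) 0 (c_mu S) (c_L S)" for k
    using assms by (simp add: A2_def)
  then have "c_mu S * (h \<bullet> h) \<le> c_L S * (h \<bullet> h)"
    unfolding hess_between_def by (meson order_trans)
  ultimately show ?thesis
    using assms by (simp add: A2_def)
qed

lemma coef_1_nonneg: "A2 S \<Longrightarrow> 0 \<le> coef_1 S"
  using A2_c_L_pos[of S] by (simp add: coef_1_def num_outcomes_def)

lemma coef_2_nonneg: "A2 S \<Longrightarrow> 0 \<le> coef_2 S"
  using coef_1_nonneg[of S] by (simp add: coef_2_def num_outcomes_def A2_def)

lemma rho_nonneg: "0 \<le> rho_s S" "0 \<le> rho_w S"
proof -
  have "{T. sum_zero T} \<noteq> {}"
    by (auto simp: sum_zero_def intro!: exI[of _ 0])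
  then show "0 \<le> rho_s S" "0 \<le> rho_w S"
    unfolding rho_s_def rho_w_def err_s_def err_w_def by (auto intro!: cINF_greatest)
qed

lemma rho_sw_nonneg: "estimators S \<Longrightarrow> 0 \<le> rho_sw S W"
  unfolding rho_sw_def
  by (rule cINF_greatest) (auto simp: estimators_def intro!: exI[of _ 0])

lemma E_imit_nonneg: "estimators S \<Longrightarrow> A2 S \<Longrightarrow> 0 \<le> E_imit S"
  unfolding E_imit_def by (simp add: coef_2_nonneg rho_sw_nonneg)

lemma E_approx_nonneg: "A2 S \<Longrightarrow> 0 \<le> E_approx S"
  unfolding E_approx_def by (simp add: coef_1_nonneg rho_nonneg)

text \<open>The almost sure bound on a norm forces the sign because the sample law is a probability
  measure: a deterministic statement that holds almost surely is true.\<close>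

lemma c_B_Theta_w_nonneg:
  assumes "decision_problem S" "estimators S"
  shows "0 \<le> c_B_Theta_w S"
proof -
  have "prob_space (joint S)"
    using assms(1) unfolding decision_problem_def by blast
  then interpret prob_space "labeled S"
    unfolding labeled_def by (rule prob_space_PiM)
  have "AE b in labeled S. norm (Theta_w_hat S b) \<le> c_B_Theta_w S"
    using assms(2) by (simp add: estimators_def)
  then have "AE b in labeled S. 0 \<le> c_B_Theta_w S"
    by eventually_elim (meson norm_ge_zero order_trans)
  then show ?thesis
    by simp
qed

lemma C_N_nonneg:
  assumes "decision_problem S" "estimators S" "A2 S"
  shows "0 \<le> C_N S"
proof -
  have "0 \<le> C_unif S"
    unfolding C_unif_def by (rule order_trans[OF abs_ge_zero Max_ge]) auto
  moreover have "0 \<le> c_B S" "0 < c_mu S"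
    using assms by (auto simp: estimators_def A2_def)
  ultimately show ?thesis
    unfolding C_N_def Sigma_s_def
    using coef_1_nonneg[OF assms(3)] coef_2_nonneg[OF assms(3)] c_B_Theta_w_nonneg[OF assms(1,2)]
      A2_c_L_pos[OF assms(3)]
    by (intro add_nonneg_nonneg mult_nonneg_nonneg divide_nonneg_pos)
      (auto simp: trace_cross_moment_nonneg real_root_ge_zero)
qed

section \<open>The threshold on the unlabeled sample size and the risk comparison\<close>

lemma C_t_eq: "C_t S = coef_1 S * lam_max_w S * (4 / (mu_w S)\<^sup>2 * trace (Sigma_w S))"
  by (simp add: C_t_def coef_1_def)

text \<open>At the root \<open>s\<close> one has a/s + D/s^2 = M. The hypothesis makes
  \<open>sqrt N\<close> at least \<open>s\<close> up to the factor \<open>max 1 (1 / c)\<close>, and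
  both terms decrease in \<open>N\<close>.\<close>

lemma quadratic_threshold_bound:
  fixes a D M N c :: real
  assumes "0 \<le> a" "0 \<le> D" "0 < M" "0 < N" "0 < c"
    and N: "c * ((a + sqrt (a\<^sup>2 + 4 * M * D)) / (2 * M))\<^sup>2 \<le> N"
  shows "a / sqrt N + D / N \<le> max 1 (1 / c) * M"
proof -
  define s where "s = (a + sqrt (a\<^sup>2 + 4 * M * D)) / (2 * M)"
  have s0: "0 \<le> s"
    using assms(1-3) by (simp add: s_def)
  have root: "a * s + D = M * s\<^sup>2"
  proof -
    have "(2 * M * s - a)\<^sup>2 = a\<^sup>2 + 4 * M * D"
      using assms(1-3) by (simp add: s_def)
    then have "4 * M * (a * s + D) = 4 * M * (M * s\<^sup>2)"
      by (simp add: power2_eq_square algebra_simps)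
    then show ?thesis
      using assms by simp
  qed
  \<comment> \<open>\<open>1 / c \<le> m\<close> gives s^2 \<le> m N, which handles the term in 1/N.
    \<open>1 \<le> m\<close> then allows m \<le> m^2, so that s \<le> m sqrt N handles the other
    term with the same factor.\<close>
  define m where "m = max 1 (1 / c)"
  have m: "1 \<le> m" "1 / c \<le> m"
    by (auto simp: m_def)
  have sN: "s\<^sup>2 \<le> m * N"
  proof -
    have "s\<^sup>2 \<le> 1 / c * N"
      using N \<open>0 < c\<close> unfolding s_def[symmetric] by (simp add: field_simps)
    also have "\<dots> \<le> m * N"
      using m \<open>0 < N\<close> by (intro mult_right_mono) auto
    finally show ?thesis .
  qed
  have "s\<^sup>2 \<le> (m * sqrt N)\<^sup>2"
  proof -
    have "m * N \<le> m\<^sup>2 * N"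
      using m \<open>0 < N\<close> by (intro mult_right_mono) (auto simp: power2_eq_square)
    moreover have "(m * sqrt N)\<^sup>2 = m\<^sup>2 * N"
      using \<open>0 < N\<close> by (simp add: power_mult_distrib)
    ultimately show ?thesis
      using sN by linarith
  qed
  moreover have "0 \<le> m * sqrt N"
    using m \<open>0 < N\<close> by simp
  ultimately have s1: "s \<le> m * sqrt N"
    by (rule power2_le_imp_le)
  show ?thesis
  proof (cases "s = 0")
    case True
    \<comment> \<open>A vanishing root kills \<open>D\<close> through the root equation and
      \<open>a\<close> through the numerator of \<open>s\<close>, a sum of nonnegative
      terms.\<close>
    then have "D = 0" "a = 0"
      using root assms(1-3) real_sqrt_ge_zero[of "a\<^sup>2 + 4 * M * D"]
      by (auto simp: s_def add_nonneg_eq_0_iff)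
    then show ?thesis
      using assms by simp
  next
    case False
    define u where "u = 1 / s"
    have u: "s * u = 1"
      using False by (simp add: u_def)
    have N_inv: "1 / sqrt N \<le> m * u" "1 / N \<le> m * u\<^sup>2"
      using s1 sN s0 False \<open>0 < N\<close> by (simp_all add: u_def divide_simps mult.commute)
    have "a / sqrt N + D / N \<le> a * (m * u) + D * (m * u\<^sup>2)"
      using mult_left_mono[OF N_inv(1) \<open>0 \<le> a\<close>] mult_left_mono[OF N_inv(2) \<open>0 \<le> D\<close>] by simp
    \<comment> \<open>The factor \<open>s * u\<close>, equal to 1, is inserted so that both terms
      carry u^2 and the root equation applies.\<close>
    also have "\<dots> = m * (a * (s * u) * u + D * u\<^sup>2)"
      unfolding u by (simp add: algebra_simps)
    also have "a * (s * u) * u + D * u\<^sup>2 = (a * s + D) * u\<^sup>2"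
      by (simp add: power2_eq_square algebra_simps)
    also have "\<dots> = M * (s * u)\<^sup>2"
      unfolding root by (simp add: power_mult_distrib)
    finally show ?thesis
      unfolding u m_def by simp
  qed
qed

text \<open>The implicit constants of (U), (S), (i) and (iii) appear as explicit positive reals, and
  the constant in the conclusion is built from these alone, free of problem parameters.\<close>

theorem corollary1:
  fixes S :: "('d::finite, 'x::finite, 'p::finite, 'k::finite) w2s_problem"
    and a_U C_U c_S c_i c_iii :: real
  assumes "decision_problem S" and "estimators S"
    and "A1 S" and "A2 S" and "A3 S" and "A4 S" and "A5 S" and "A6 S" and "A7 S" and "A8 S"
    and "a_U > 0" and "C_U > 0" and "c_S > 0" and "c_i > 0" and "c_iii > 0" and "c_iii \<ge> a_U"
    and U: "real (n_unl S) \<ge> a_U * d_s S \<Longrightarrow>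
      excess_w2s S \<le> C_U * (E_imit S + C_N S / sqrt (real (n_unl S)) + E_teacher S + E_approx S)"
    and S: "excess_s S \<ge> c_S *
      (c_mu S * (c_gamma S)\<^sup>2 * (exp (- 4 * c_B_eta S) / (num_outcomes S)\<^sup>2) *
        (rho_s S + lam_min_s S * trace (Sigma_grad S) / (c_L_H S)\<^sup>2 * (1 / real (n_lab S))))"
    and W: "weak_mse S \<le> 4 / (mu_w S)\<^sup>2 * (trace (Sigma_w S) / real (n_lab S))
      + 4 * (c_B_Theta S)\<^sup>2 * d_w S *
          exp (- (real (n_lab S) * lambda_min (Sigma_w S) / (8 * (c_B_phi S)\<^sup>2)))"
    and i: "(c_B_Theta S)\<^sup>2 * d_w S *
          exp (- (real (n_lab S) * lambda_min (Sigma_w S) / (8 * (c_B_phi S)\<^sup>2)))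
      \<le> c_i * (trace (Sigma_w S) / ((mu_w S)\<^sup>2 * real (n_lab S)))"
    and ii: "E_imit S + E_approx S + C_t S * d_sw S / real (n_lab S)
      < c_mu S * (c_gamma S)\<^sup>2 * (exp (- 4 * c_B_eta S) / (num_outcomes S)\<^sup>2) *
        (rho_s S + lam_min_s S * trace (Sigma_grad S) / ((c_L_H S)\<^sup>2 * real (n_lab S)))"
    and iii: "real (n_unl S) \<ge> c_iii * max (d_s S)
      (((C_N S + sqrt ((C_N S)\<^sup>2
            + 4 * M_n S * C_t S * d_s S * (d_w S - d_sw S) / real (n_lab S))) / (2 * M_n S))\<^sup>2)"
  shows "excess_w2s S \<le> (C_U / c_S * (1 + c_i) * max 1 (1 / c_iii)) * excess_s S"
proof -
  let ?n = "real (n_lab S)" and ?N = "real (n_unl S)"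
  define D where "D = C_t S * d_s S * (d_w S - d_sw S) / ?n"
  define T where "T = C_t S * d_sw S / ?n"
  define m where "m = max 1 (1 / c_iii)"
  have n: "0 < ?n" and N: "0 < ?N"
    using assms(1) by (auto simp: decision_problem_def)
  have dsw: "0 \<le> d_s S" "0 \<le> d_sw S" "d_sw S \<le> d_w S"
    using d_sw_le_d_w[OF assms(1,6)] by (auto simp: d_s_def d_sw_def)
  have tr: "0 \<le> trace (Sigma_w S)"
    by (simp add: Sigma_w_def trace_cross_moment_nonneg)
  have pre: "0 \<le> coef_1 S * lam_max_w S"
    using coef_1_nonneg[OF assms(4)] lam_max_w_nonneg[OF assms(1)] by simp
  have C_t: "0 \<le> C_t S"
    unfolding C_t_eq using pre tr by simp
  have nonneg: "0 \<le> D" "0 \<le> T" "0 \<le> E_imit S" "0 \<le> E_approx S" "0 \<le> C_N S"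
    using C_t dsw E_imit_nonneg[OF assms(2,4)] E_approx_nonneg[OF assms(4)] C_N_nonneg[OF assms(1,2,4)] by (auto simp: D_def T_def)
  have M: "0 < M_n S"
    using ii by (simp add: M_n_def strong_lower_def)
  have m: "1 \<le> m" "0 < m"
    by (auto simp: m_def)

  \<comment> \<open>The exponential tail in \<open>W\<close> carries the same factor 4 as the
    leading term, so \<open>i\<close> bounds it by \<open>c_i\<close> copies of that term.\<close>
  have "weak_mse S \<le> (1 + c_i) * (4 / (mu_w S)\<^sup>2 * trace (Sigma_w S) / ?n)"
  proof -
    have "weak_mse S \<le> 4 * (trace (Sigma_w S) / ((mu_w S)\<^sup>2 * ?n))
        + 4 * (c_i * (trace (Sigma_w S) / ((mu_w S)\<^sup>2 * ?n)))"
      using W i by simp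
    also have "\<dots> = (1 + c_i) * (4 / (mu_w S)\<^sup>2 * trace (Sigma_w S) / ?n)"
      by (simp add: distrib_right add_divide_distrib mult.left_commute)
    finally show ?thesis .
  qed
  then have "coef_1 S * lam_max_w S * weak_mse S
      \<le> coef_1 S * lam_max_w S * ((1 + c_i) * (4 / (mu_w S)\<^sup>2 * trace (Sigma_w S) / ?n))"
    using pre by (rule mult_left_mono)
  \<comment> \<open>\<open>C_t S\<close> is the teacher prefactor times the leading term of (W)
    without its 1/n.\<close>
  also have "\<dots> = (1 + c_i) * (C_t S / ?n)"
    by (simp add: C_t_eq)
  finally have "E_teacher S \<le> (1 + c_i) * (C_t S / ?n) * (d_sw S + 1 / ?N * d_s S * (d_w S - d_sw S))"
    unfolding E_teacher_def using dsw by (intro mult_right_mono) auto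
  also have "\<dots> = (1 + c_i) * (T + D / ?N)"
    by (simp add: T_def D_def algebra_simps add_divide_distrib diff_divide_distrib)
  finally have teacher: "E_teacher S \<le> (1 + c_i) * (T + D / ?N)" .

  have "4 * M_n S * C_t S * d_s S * (d_w S - d_sw S) / ?n = 4 * M_n S * D"
    by (simp add: D_def mult.assoc)
  moreover have "c_iii * t \<le> c_iii * max (d_s S) t" for t
    using \<open>c_iii > 0\<close> by (intro mult_left_mono) auto
  ultimately have "c_iii * ((C_N S + sqrt ((C_N S)\<^sup>2 + 4 * M_n S * D)) / (2 * M_n S))\<^sup>2 \<le> ?N"
    using order_trans[OF _ iii] by simp
  then have absorbed: "C_N S / sqrt ?N + D / ?N \<le> m * M_n S"
    unfolding m_def using nonneg M N \<open>c_iii > 0\<close> by (intro quadratic_threshold_bound) auto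

  \<comment> \<open>\<open>c_iii \<ge> a_U\<close> is what lets (iii) imply the sample size
    requirement of (U).\<close>
  have "a_U * d_s S \<le> c_iii * d_s S"
    using \<open>c_iii \<ge> a_U\<close> dsw by (intro mult_right_mono)
  also have "\<dots> \<le> c_iii * max (d_s S) t" for t
    using \<open>c_iii > 0\<close> by (intro mult_left_mono) auto
  also note iii
  finally have "excess_w2s S
      \<le> C_U * (E_imit S + C_N S / sqrt ?N + E_teacher S + E_approx S)"
    by (rule U)
  also have "\<dots> \<le> C_U * ((1 + c_i) * m * strong_lower S)"
  proof (rule mult_left_mono)
    let ?E = "E_imit S + E_approx S"
    have "E_imit S + C_N S / sqrt ?N + E_teacher S + E_approx S
        \<le> ?E + C_N S / sqrt ?N + (1 + c_i) * (T + D / ?N)"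
      using teacher by simp
    \<comment> \<open>Only the teacher term carries 1 + c_i; the other terms are nonnegative and are
      inflated by the same factor.\<close>
    also have "\<dots> \<le> (1 + c_i) * (?E + C_N S / sqrt ?N + (T + D / ?N))"
    proof -
      have "X + (1 + c_i) * Z \<le> (1 + c_i) * (X + Z)" if "0 \<le> X" for X Z
        using that \<open>c_i > 0\<close> by (simp add: algebra_simps)
      then show ?thesis
        using nonneg by simp
    qed
    also have "\<dots> \<le> (1 + c_i) * (m * strong_lower S)"
    proof (rule mult_left_mono)
      \<comment> \<open>Inflating \<open>?E + T\<close> by \<open>m\<close> as well lets it combine
        with \<open>m * M_n S\<close>: by definition \<open>M_n S\<close> is what remains of
        \<open>strong_lower S\<close> after subtracting \<open>?E + T\<close>.\<close>
      have "?E + T \<le> m * (?E + T)"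
        using m nonneg mult_right_mono[of 1 m "?E + T"] by simp
      then have "?E + C_N S / sqrt ?N + (T + D / ?N) \<le> m * (?E + T) + m * M_n S"
        using absorbed by simp
      also have "\<dots> = m * strong_lower S"
        by (simp add: M_n_def T_def algebra_simps)
      finally show "?E + C_N S / sqrt ?N + (T + D / ?N) \<le> m * strong_lower S" .
    qed (use \<open>c_i > 0\<close> in simp)
    finally show "E_imit S + C_N S / sqrt ?N + E_teacher S + E_approx S \<le> (1 + c_i) * m * strong_lower S"
      by (simp add: mult.assoc)
  qed (use \<open>C_U > 0\<close> in simp)
  also have "\<dots> = C_U / c_S * (1 + c_i) * m * (c_S * strong_lower S)"
    using \<open>c_S > 0\<close> by simp
  also have "\<dots> \<le> C_U / c_S * (1 + c_i) * m * excess_s S"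
    using S \<open>C_U > 0\<close> \<open>c_S > 0\<close> \<open>c_i > 0\<close> m
    by (intro mult_left_mono) (auto simp: strong_lower_def)
  finally show ?thesis
    by (simp add: m_def)
qed

end
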